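(* Let $(X,d)$ be a complete metric space and let $\mathcal{A}=\{\mathcal{A}(t)\}_{t\in\mathbb{R}}$ be a selected pullback attractor of a generalized process in $X$ which is forward compact, i.e., $\overline{\bigcup_{s\ge t}\mathcal{A}(s)}$ is a compact set for all $t\in\mathbb{R}$. Then $$\lim_{t\to\infty}\mathrm{dist}(\mathcal{A}(t),\mathcal{A}(\infty))=0,$$ where $\mathcal{A}(\infty):=\bigcap_{t\in\mathbb{R}}\overline{\bigcup_{r\ge t}\mathcal{A}(r)}$.
   Context: Let $(X,d)$ be a complete metric space. For nonempty $A,B\subset X$: $\mathrm{dist}(A,B)=\sup_{a\in A}\inf_{b\in B}d(a,b)$; for $\varepsilon>0$, $\mathcal{O}_\varepsilon(A)=\{z\in X:\inf_{a\in A}d(z,a)<\varepsilon\}$. Generalized process: a family $\mathscr{G}=\{\mathscr{G}(\tau)\}_{\tau\in\mathbb{R}}$ of sets $\mathscr{G}(\tau)$ consisting of functions $\varphi:[\tau,\infty)\to X$ (called solutions) such that: (C1) for each $\tau\in\mathbb{R}$ and $z\in X$ there is at least one $\varphi\in\mathscr{G}(\tau)$ with $\varphi(\tau)=z$; (C2) if $\varphi\in\mathscr{G}(\tau)$ and $s\ge 0$, then $\varphi|_{[\tau+s,\infty)}\in\mathscr{G}(\tau+s)$; (C3) if $\{\varphi_j\}_{j\in\mathbb{N}}\subset\mathscr{G}(\tau)$ and $\varphi_j(\tau)\to z$, then there are a subsequence $\{\varphi_{j_k}\}$ and $\varphi\in\mathscr{G}(\tau)$ with $\varphi(\tau)=z$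 and $\varphi_{j_k}(t)\to\varphi(t)$ as $k\to\infty$ for each $t\ge\tau$. A family $\mathcal{A}=\{\mathcal{A}(t)\}_{t\in\mathbb{R}}$ select pullback attracts $x\in X$ at time $t\in\mathbb{R}$ if for every $\varepsilon>0$ there is $\tau_0\le t$ such that for all $\tau\le\tau_0$ there is $\varphi_\tau\in\mathscr{G}(\tau)$ with $\varphi_\tau(\tau)=x$ and $\varphi_\tau(t)\in\mathcal{O}_\varepsilon(\mathcal{A}(t))$. A (global) selected pullback attractor of $\mathscr{G}$ is a family $\mathcal{A}=\{\mathcal{A}(t)\}_{t\in\mathbb{R}}$ of nonempty compact subsets of $X$ which select pullback attracts every $x\in X$ at every time $t\in\mathbb{R}$. *)

theory Defs
  imports "HOL-Analysis.Analysis"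
begin

text \<open>
  A function on \<open>[\<tau>, \<infinity>)\<close> is represented by a total function that is
  \<^const>\<open>undefined\<close> off \<open>{\<tau>..}\<close>, so that two solutions in \<open>G \<tau>\<close> are
  equal iff they agree on \<open>[\<tau>, \<infinity>)\<close>.
\<close>

locale generalized_process =
  fixes G :: "real \<Rightarrow> (real \<Rightarrow> 'a::metric_space) set"
  assumes solutions: "G \<tau> \<subseteq> extensional {\<tau>..}"
    and C1: "\<exists>\<phi>\<in>G \<tau>. \<phi> \<tau> = z"
    and C2: "\<phi> \<in> G \<tau> \<Longrightarrow> 0 \<le> s \<Longrightarrow> restrict \<phi> {\<tau> + s..} \<in> G (\<tau> + s)"
    and C3: "(\<And>j::nat. \<psi> j \<in> G \<tau>) \<Longrightarrow> (\<lambda>j. \<psi> j \<tau>) \<longlonglongrightarrow> z \<Longrightarrow>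
      \<exists>k::nat \<Rightarrow> nat. strict_mono k \<and>
        (\<exists>\<phi>\<in>G \<tau>. \<phi> \<tau> = z \<and> (\<forall>t\<ge>\<tau>. (\<lambda>i. \<psi> (k i) t) \<longlonglongrightarrow> \<phi> t))"

text \<open>
  The semidistance takes values in \<^typ>\<open>ennreal\<close>: suprema of unbounded sets are
  then \<open>\<infinity>\<close>, and so is the distance from a point to the empty set (whereas
  \<^const>\<open>infdist\<close> would return \<open>0\<close>). For nonempty bounded sets the value is the
  usual real number.
\<close>

definition hausdorff_semidist :: "'a::metric_space set \<Rightarrow> 'a set \<Rightarrow> ennreal" where
  "hausdorff_semidist A B = (SUP a\<in>A. INF b\<in>B. ennreal (dist a b))"

text \<open>Only meant for nonempty \<open>A\<close>, where \<^const>\<open>infdist\<close> is the infimum of the distances.\<close>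

definition eps_nbhd :: "real \<Rightarrow> 'a::metric_space set \<Rightarrow> 'a set" where
  "eps_nbhd \<epsilon> A = {z. infdist z A < \<epsilon>}"

definition select_pullback_attracts ::
    "(real \<Rightarrow> (real \<Rightarrow> 'a::metric_space) set) \<Rightarrow> (real \<Rightarrow> 'a set) \<Rightarrow> 'a \<Rightarrow> real \<Rightarrow> bool" where
  "select_pullback_attracts G A x t \<longleftrightarrow>
    (\<forall>\<epsilon>>0. \<exists>\<tau>\<^sub>0\<le>t. \<forall>\<tau>\<le>\<tau>\<^sub>0. \<exists>\<phi>\<in>G \<tau>. \<phi> \<tau> = x \<and> \<phi> t \<in> eps_nbhd \<epsilon> (A t))"

definition selected_pullback_attractor ::
    "(real \<Rightarrow> (real \<Rightarrow> 'a::metric_space) set) \<Rightarrow> (real \<Rightarrow> 'a set) \<Rightarrow> bool" where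
  "selected_pullback_attractor G A \<longleftrightarrow>
    (\<forall>t. A t \<noteq> {} \<and> compact (A t)) \<and> (\<forall>x t. select_pullback_attracts G A x t)"

definition forward_compact :: "(real \<Rightarrow> 'a::metric_space set) \<Rightarrow> bool" where
  "forward_compact A \<longleftrightarrow> (\<forall>t. compact (closure (\<Union>s\<in>{t..}. A s)))"

definition limit_at_infinity :: "(real \<Rightarrow> 'a::metric_space set) \<Rightarrow> 'a set" where
  "limit_at_infinity A = (\<Inter>t. closure (\<Union>r\<in>{t..}. A r))"

end

theory Submission
  imports Defs
begin

text \<open>
  \<open>A(\<infinity>)\<close> is a decreasing intersection of compact sets, so each of its open neighbourhoods contains one of these sets, and hence all later \<open>A(t)\<close>.
\<close>

lemma forward_compact_eventually_subset:
  assumes A: "forward_compact A" and U: "open U" "limit_at_infinity A \<subseteq> U"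
  shows "\<forall>\<^sub>F t in at_top. A t \<subseteq> U"
proof -
  define K where "K t = closure (\<Union>r\<in>{t..}. A r)" for t
  have mono: "K t \<subseteq> K s" if "s \<le> t" for s t
    unfolding K_def using that by (intro closure_mono UN_mono) auto
  have "\<exists>T. K T \<subseteq> U"
  proof (rule ccontr)
    assume not_sub: "\<nexists>T. K T \<subseteq> U"
    \<comment> \<open>Finite intersection property inside the compact set \<open>K 0 - U\<close>;
      the index 0 is an arbitrary choice. A common point would lie in
      \<open>limit_at_infinity A\<close> but outside \<open>U\<close>.\<close>
    have "(K 0 - U) \<inter> (\<Inter>t\<in>UNIV. K t) \<noteq> {}"
    proof (rule compact_imp_fip_image)
      show "compact (K 0 - U)"
        using A U(1) by (auto simp: forward_compact_def K_def intro: compact_diff)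
      show "closed (K t)" for t
        by (simp add: K_def)
      show "(K 0 - U) \<inter> (\<Inter>t\<in>I. K t) \<noteq> {}" if I: "finite I" for I
      proof -
        \<comment> \<open>Inserting 0 keeps \<open>Max\<close> meaningful for empty \<open>I\<close>
          and gives \<open>K T \<subseteq> K 0\<close>, so a point of \<open>K T - U\<close> lies in
          \<open>K 0 - U\<close> and in every \<open>K t\<close> with
          \<open>t \<in> I\<close>.\<close>
        define T where "T = Max (insert 0 I)"
        have "t \<le> T" if "t \<in> insert 0 I" for t
          unfolding T_def using I that by (intro Max_ge) auto
        moreover obtain z where "z \<in> K T" "z \<notin> U"
          using not_sub by blast
        ultimately show ?thesis
          using mono by blast
      qed
    qed
    then show False
      using U(2) unfolding limit_at_infinity_def K_def by blast
  qed
  then obtain T where "K T \<subseteq> U" by blast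
  moreover have "A t \<subseteq> K T" if "T \<le> t" for t
    unfolding K_def using that by (intro order_trans[OF _ closure_subset]) auto
  ultimately show ?thesis
    unfolding eventually_at_top_linorder by blast
qed

text \<open>Each inner infimum is bounded by the distance to one ball centre. The supremum over
  \<open>A\<close> may reach \<open>e\<close>, so strictness is lost.\<close>

lemma hausdorff_semidist_le:
  assumes "A \<subseteq> (\<Union>b\<in>B. ball b e)"
  shows "hausdorff_semidist A B \<le> ennreal e"
  unfolding hausdorff_semidist_def
proof (rule SUP_least)
  fix a assume "a \<in> A"
  then obtain b where "b \<in> B" "dist a b < e"
    using assms by (auto simp: dist_commute)
  then show "(INF b\<in>B. ennreal (dist a b)) \<le> ennreal e"
    by (intro INF_lower2[of b] ennreal_leI) auto
qed

theorem theorem12: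
  fixes G :: "real \<Rightarrow> (real \<Rightarrow> 'a::complete_space) set"
    and A :: "real \<Rightarrow> 'a set"
  assumes "generalized_process G"
    and "selected_pullback_attractor G A"
    and "forward_compact A"
  shows "((\<lambda>t. hausdorff_semidist (A t) (limit_at_infinity A)) \<longlongrightarrow> 0) at_top"
proof (rule order_tendstoI)
  fix a :: ennreal assume "0 < a"
  \<comment> \<open>The gap \<open>c < a\<close> restores the strict inequality after a weak bound
    by \<open>c\<close>, and makes \<open>c\<close> finite, hence a real radius \<open>e\<close>,
    even if \<open>a\<close> is infinite.\<close>
  then obtain c where c: "0 < c" "c < a"
    using dense by blast
  then obtain e where e: "c = ennreal e" "0 < e"
    by (cases c) auto
  have "\<forall>\<^sub>F t in at_top. A t \<subseteq> (\<Union>b\<in>limit_at_infinity A. ball b e)"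
    using assms(3) e(2) by (intro forward_compact_eventually_subset) auto
  then show "\<forall>\<^sub>F t in at_top. hausdorff_semidist (A t) (limit_at_infinity A) < a"
    by eventually_elim (use hausdorff_semidist_le c(2) e(1) in \<open>blast intro: le_less_trans\<close>)
\<comment> \<open>The other half of \<open>order_tendstoI\<close> is vacuous: no
  \<open>ennreal\<close> lies below 0.\<close>
qed simp

end
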